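(* Let $G$ be a set, $k,\ell\ge1$, $\vec r\in\mathbb Z_{\ge1}^k$, $\vec a\in G^k$, $\vec s\in\mathbb Z_{\ge1}^\ell$, $\vec b\in G^\ell$. Then in $(\mathcal H(\mathbb Z_{\ge1}\times G),\sqcup\!\sqcup_\rho)$, $$\binom{\vec r}{\vec a}\sqcup\!\sqcup_\rho\binom{\vec s}{\vec b}=\sum_{\substack{\sigma\in S(k,\ell)\\ \vec t\in\mathbb Z_{\ge1}^{k+\ell},\ |\vec t|=|\vec r|+|\vec s|}}\Big(\prod_{i=1}^{k+\ell}\binom{t_i-1}{\kappa_{\sigma(i)}-1-\frac12\big(1-\varepsilon_\sigma(i)\varepsilon_\sigma(i-1)\big)\sum_{j=1}^{i-1}(t_j-\kappa_{\sigma(j)})}\Big)\binom{\vec t}{\vec a\sqcup\!\sqcup_\sigma\vec b},$$ with the convention $\varepsilon_\sigma(0)=\varepsilon_\sigma(1)$.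
   Context: Words: $\binom{s_1,\dots,s_m}{b_1,\dots,b_m}$ denotes the word $(s_1,b_1)\cdots(s_m,b_m)$ in the free monoid on $\mathbb Z_{\ge1}\times G$; empty word $1$; $\mathcal H(\mathbb Z_{\ge1}\times G)$ is the free abelian group on these words. Let $x_0$ and $x_b$ ($b\in G$) be pairwise distinct letters (indexed by $\{0\}\sqcup G$), $\sqcup\!\sqcup$ the shuffle product on words in them ($1\sqcup\!\sqcup w=w\sqcup\!\sqcup1=w$, $(a_1u)\sqcup\!\sqcup(b_1v)=a_1(u\sqcup\!\sqcup b_1v)+b_1(a_1u\sqcup\!\sqcup v)$), $\mathcal H_1$ the span of $1$ and words ending in some $x_b$ (basis $1$ and $x_0^{s_1-1}x_{b_1}\cdots x_0^{s_m-1}x_{b_m}$), $\rho$ the linear bijection $x_0^{s_1-1}x_{b_1}\cdots x_0^{s_m-1}x_{b_m}\mapsto\binom{s_1,\dots,s_m}{b_1,\dots,b_m}$, $1\mapsto1$, and $u\sqcup\!\sqcup_\rho v=\rho(\rho^{-1}u\sqcup\!\sqcup\rho^{-1}v)$. $|\vec x|$ is the sum of entries. $S(k,\ell)$ is the set of permutations $\sigma$ of $\{1,\dots,k+\ell\}$ with $\sigma^{-1}(1)<\cdots<\sigma^{-1}(k)$ and $\sigma^{-1}(k+1)<\cdots<\sigma^{-1}(k+\ell)$. $\varepsilon_\sigma(i)=1$ if $1\le\sigma(i)\le k$ and $-1$ if $k+1\le\sigma(i)\le k+\ell$. $\vec\kappa=(r_1,\dots,r_k,s_1,\dots,s_\ell)$,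 $\vec\gamma=(a_1,\dots,a_k,b_1,\dots,b_\ell)$, and $\vec a\sqcup\!\sqcup_\sigma\vec b=(\gamma_{\sigma(1)},\dots,\gamma_{\sigma(k+\ell)})$. For integers $a\ge0$ and $b$, $\binom ab$ is the usual binomial coefficient if $0\le b\le a$ and $0$ otherwise. *)

theory Defs
  imports "HOL-Library.Poly_Mapping" "HOL-Combinatorics.Permutations"
begin

text \<open>
  The set \<open>G\<close> is the type \<open>'g\<close>. The free abelian group on a set \<open>S\<close> of words is the set
  of all \<open>c :: 'a list \<Rightarrow>\<^sub>0 int\<close> with \<open>keys c \<subseteq> S\<close>; a word \<open>w\<close> is the element \<open>frag_of w\<close>.
\<close>

datatype 'g letter = X0 | X 'g

fun shuffle_words :: "'a list \<Rightarrow> 'a list \<Rightarrow> 'a list \<Rightarrow>\<^sub>0 int" where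
  "shuffle_words [] w = frag_of w"
| "shuffle_words w [] = frag_of w"
| "shuffle_words (a # u) (b # v) =
     frag_extend (\<lambda>w. frag_of (a # w)) (shuffle_words u (b # v)) +
     frag_extend (\<lambda>w. frag_of (b # w)) (shuffle_words (a # u) v)"

definition shuffle :: "('a list \<Rightarrow>\<^sub>0 int) \<Rightarrow> ('a list \<Rightarrow>\<^sub>0 int) \<Rightarrow> 'a list \<Rightarrow>\<^sub>0 int" where
  "shuffle p q = frag_extend (\<lambda>u. frag_extend (\<lambda>v. shuffle_words u v) q) p"

definition zwords :: "(nat \<times> 'g) list set" where
  "zwords = {ws. \<forall>(s, b) \<in> set ws. 1 \<le> s}"

definition H :: "((nat \<times> 'g) list \<Rightarrow>\<^sub>0 int) set" where
  "H = {c. Poly_Mapping.keys c \<subseteq> zwords}"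

definition H1 :: "('g letter list \<Rightarrow>\<^sub>0 int) set" where
  "H1 = {c. Poly_Mapping.keys c \<subseteq> {w. w = [] \<or> (\<exists>b. last w = X b)}}"

definition xword :: "(nat \<times> 'g) list \<Rightarrow> 'g letter list" where
  "xword ws = concat (map (\<lambda>(s, b). replicate (s - 1) X0 @ [X b]) ws)"

text \<open>\<open>\<rho>\<close> and its inverse are meaningful on \<open>H1\<close> and \<open>H\<close> only; see \<open>bij_betw_rho\<close> below.\<close>

definition rho :: "('g letter list \<Rightarrow>\<^sub>0 int) \<Rightarrow> (nat \<times> 'g) list \<Rightarrow>\<^sub>0 int" where
  "rho = frag_extend (\<lambda>w. frag_of (inv_into zwords xword w))"

definition rho_inv :: "((nat \<times> 'g) list \<Rightarrow>\<^sub>0 int) \<Rightarrow> 'g letter list \<Rightarrow>\<^sub>0 int" where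
  "rho_inv = inv_into H1 rho"

definition shuffle_rho ::
  "((nat \<times> 'g) list \<Rightarrow>\<^sub>0 int) \<Rightarrow> ((nat \<times> 'g) list \<Rightarrow>\<^sub>0 int) \<Rightarrow> (nat \<times> 'g) list \<Rightarrow>\<^sub>0 int" where
  "shuffle_rho u v = rho (shuffle (rho_inv u) (rho_inv v))"

definition two_row :: "nat list \<Rightarrow> 'g list \<Rightarrow> (nat \<times> 'g) list \<Rightarrow>\<^sub>0 int" where
  "two_row s b = frag_of (zip s b)"

text \<open>Vectors are lists whose entries are numbered from 1.\<close>

definition entry :: "'a list \<Rightarrow> nat \<Rightarrow> 'a" where
  "entry v i = v ! (i - 1)"

definition shuffle_perms :: "nat \<Rightarrow> nat \<Rightarrow> (nat \<Rightarrow> nat) set" where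
  "shuffle_perms k l = {\<sigma>. \<sigma> permutes {1..k + l} \<and>
     strict_mono_on {1..k} (inv \<sigma>) \<and> strict_mono_on {k + 1..k + l} (inv \<sigma>)}"

text \<open>The case \<open>i = 0\<close> is the convention that index 0 has the sign of index 1.\<close>

definition eps :: "nat \<Rightarrow> (nat \<Rightarrow> nat) \<Rightarrow> nat \<Rightarrow> int" where
  "eps k \<sigma> i = (if \<sigma> (if i = 0 then 1 else i) \<in> {1..k} then 1 else - 1)"

definition shuffle_vec :: "(nat \<Rightarrow> nat) \<Rightarrow> 'g list \<Rightarrow> 'g list \<Rightarrow> 'g list" where
  "shuffle_vec \<sigma> a b = map (\<lambda>i. entry (a @ b) (\<sigma> i)) [1..<length a + length b + 1]"

definition ibinom :: "int \<Rightarrow> int \<Rightarrow> int" where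
  "ibinom a b = (if 0 \<le> b \<and> b \<le> a then int (nat a choose nat b) else 0)"

definition compositions :: "nat \<Rightarrow> nat \<Rightarrow> nat list set" where
  "compositions n N = {t. length t = n \<and> (\<forall>x \<in> set t. 1 \<le> x) \<and> sum_list t = N}"

text \<open>The division by 2 is exact, as \<open>1 - eps k \<sigma> i * eps k \<sigma> (i - 1)\<close> is 0 or 2.\<close>

definition shuffle_coeff ::
  "nat \<Rightarrow> nat \<Rightarrow> nat list \<Rightarrow> (nat \<Rightarrow> nat) \<Rightarrow> nat list \<Rightarrow> int" where
  "shuffle_coeff k l \<kappa> \<sigma> t =
     (\<Prod>i = 1..k + l.
        ibinom (int (entry t i) - 1)
          (int (entry \<kappa> (\<sigma> i)) - 1 -
           (1 - eps k \<sigma> i * eps k \<sigma> (i - 1)) div 2 *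
           (\<Sum>j = 1..i - 1. int (entry t j) - int (entry \<kappa> (\<sigma> j)))))"

lemma finite_shuffle_perms: "finite (shuffle_perms k l)"
  by (rule finite_subset[OF _ finite_permutations[of "{1..k + l}"]])
    (auto simp: shuffle_perms_def)

lemma finite_compositions: "finite (compositions n N)"
proof (rule finite_subset)
  show "compositions n N \<subseteq> {t. set t \<subseteq> {..N} \<and> length t = n}"
    by (auto simp: compositions_def dest: member_le_sum_list)
  show "finite {t. set t \<subseteq> {..N} \<and> length t = n}"
    by (rule finite_lists_length_eq) simp
qed

lemma xword_simps [simp]:
  "xword [] = []"
  "xword ((s, b) # ws) = replicate (s - 1) X0 @ X b # xword ws"
  by (simp_all add: xword_def)

lemma replicate_X0_inject:
  "replicate m X0 @ X b # u = replicate n X0 @ X c # v \<longleftrightarrow> m = n \<and> b = c \<and> u = v"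
proof (induction m arbitrary: n)
  case 0 then show ?case by (cases n) auto
next
  case (Suc m) then show ?case by (cases n) auto
qed

lemma inj_on_xword: "inj_on xword zwords"
proof (rule inj_onI)
  fix ws vs :: "(nat \<times> 'a) list"
  show "ws \<in> zwords \<Longrightarrow> vs \<in> zwords \<Longrightarrow> xword ws = xword vs \<Longrightarrow> ws = vs"
  proof (induction ws arbitrary: vs)
    case Nil then show ?case by (cases vs) auto
  next
    case (Cons x ws)
    obtain s b where x: "x = (s, b)" by force
    with Cons.prems(3) have "vs \<noteq> []" by auto
    then obtain t c vs' where vs: "vs = (t, c) # vs'" by (cases vs) auto
    show ?case using Cons.prems Cons.IH[of vs'] unfolding x vs
      by (auto simp: zwords_def replicate_X0_inject)
  qed
qed

lemma xword_image: "xword ` zwords = {w. w = [] \<or> (\<exists>b. last w = X b)}"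
proof (intro equalityI subsetI)
  fix w assume "w \<in> xword ` zwords"
  then obtain ws where "w = xword ws" by blast
  moreover have "xword ws = [] \<or> (\<exists>b. last (xword ws) = X b)"
  proof (induction ws)
    case (Cons x vs) then show ?case by (cases x; cases "xword vs = []") auto
  qed simp
  ultimately show "w \<in> {w. w = [] \<or> (\<exists>b. last w = X b)}" by simp
next
  fix w :: "'a letter list"
  assume "w \<in> {w. w = [] \<or> (\<exists>b. last w = X b)}"
  then have "w = [] \<or> (\<exists>b. last w = X b)" by simp
  then show "w \<in> xword ` zwords"
  proof (induction w)
    case Nil
    show ?case by (rule image_eqI[of _ _ "[]"]) (auto simp: zwords_def)
  next
    case (Cons x w)
    then have "w = [] \<or> (\<exists>b. last w = X b)" by (auto split: if_splits)
    then obtain ws where ws: "ws \<in> zwords" "w = xword ws" using Cons.IH by auto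
    show ?case
    proof (cases x)
      case (X b)
      show ?thesis
        by (rule image_eqI[of _ _ "(1, b) # ws"]) (use ws X in \<open>auto simp: zwords_def\<close>)
    next
      case X0
      with Cons.prems ws obtain s b vs where "ws = (s, b) # vs"
        by (cases ws) (auto split: if_splits)
      with ws X0 show ?thesis
        by (intro image_eqI[of _ _ "(Suc s, b) # vs"])
          (auto simp: zwords_def simp flip: replicate_Suc)
    qed
  qed
qed

lemma rho_xword: "ws \<in> zwords \<Longrightarrow> rho (frag_of (xword ws)) = frag_of ws"
  by (simp add: rho_def inv_into_f_f[OF inj_on_xword])

lemma bij_betw_rho: "bij_betw rho H1 H"
proof -
  define r' :: "((nat \<times> 'a) list \<Rightarrow>\<^sub>0 int) \<Rightarrow> 'a letter list \<Rightarrow>\<^sub>0 int"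
    where "r' = frag_extend (\<lambda>ws. frag_of (xword ws))"
  let ?W = "{w. w = [] \<or> (\<exists>b. last w = X b)} :: 'a letter list set"
  have l: "rho c \<in> H \<and> r' (rho c) = c" if "c \<in> H1" for c
  proof -
    have "Poly_Mapping.keys c \<subseteq> ?W" using that by (simp add: H1_def)
    then show ?thesis
    proof (induction c rule: frag_induction)
      case zero show ?case by (simp add: rho_def r'_def H_def)
    next
      case (one w)
      then obtain ws where "ws \<in> zwords" "w = xword ws" using xword_image by blast
      then show ?case by (simp add: rho_xword r'_def H_def)
    next
      case (diff a b)
      then show ?case using keys_diff[of "rho a" "rho b"]
        by (auto simp: rho_def r'_def H_def frag_extend_diff)
    qed
  qed
  have r: "r' c \<in> H1 \<and> rho (r' c) = c" if "c \<in> H" for c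
  proof -
    have "Poly_Mapping.keys c \<subseteq> zwords" using that by (simp add: H_def)
    then show ?thesis
    proof (induction c rule: frag_induction)
      case zero show ?case by (simp add: rho_def r'_def H1_def)
    next
      case (one ws)
      then have "xword ws \<in> ?W" using xword_image by blast
      with one show ?case by (simp add: rho_xword r'_def H1_def)
    next
      case (diff a b)
      then show ?case using keys_diff[of "r' a" "r' b"]
        by (auto simp: rho_def r'_def H1_def frag_extend_diff)
    qed
  qed
  show ?thesis
    by (rule bij_betw_byWitness[of _ r']) (use l r in auto)
qed

lemma rho_inv_word: "ws \<in> zwords \<Longrightarrow> rho_inv (frag_of ws) = frag_of (xword ws)"
proof -
  assume ws: "ws \<in> zwords"
  then have "xword ws \<in> xword ` zwords" by blast
  then have "frag_of (xword ws) \<in> H1" unfolding xword_image by (simp add: H1_def)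
  then have "inv_into H1 rho (rho (frag_of (xword ws))) = frag_of (xword ws)"
    using bij_betw_rho by (intro inv_into_f_f) (auto simp: bij_betw_def)
  with ws show ?thesis by (simp add: rho_inv_def rho_xword)
qed

end

theory Submission
  imports Defs
begin

text \<open>
  Read a word of the shuffle product block by block, a block being \<open>X0^(t - 1) X e\<close>. If the letter
  \<open>X e\<close> closing a block comes from the first word, then so do all remaining \<open>X0\<close> of its current
  block, and the other \<open>X0\<close> of the new block come from the current block of the second word; a
  binomial coefficient counts their interleavings. Iterating this, the number \<open>T\<close> of letters
  taken in advance from the word that did not supply the last closing letter is
  \<open>\<Sum>j<i. t_j - \<kappa>_j\<close>, and it is subtracted from the entry of that word exactly when the
  supplier changes. A coefficient that would take too many letters in advance vanishes on its own,
  because the binomial at the next change of supplier has a negative lower entry. The choices of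
  suppliers are lists of Booleans, which correspond to the permutations in \<open>S(k, l)\<close>.
\<close>

section \<open>Coefficients of the shuffle product\<close>

text \<open>A relabelling that is injective on a set containing the support merges no coefficients.
  Applied to prepending a letter and to the inverse of \<open>xword\<close>.\<close>

lemma lookup_frag_extend_inj:
  assumes "Poly_Mapping.keys c \<subseteq> S" "inj_on f S" "x \<in> S"
  shows "Poly_Mapping.lookup (frag_extend (\<lambda>y. frag_of (f y)) c) (f x) = Poly_Mapping.lookup c x"
  using assms(1)
proof (induction c rule: frag_induction)
  case (one y)
  then show ?case using assms(2,3) by (auto simp: lookup_single when_def inj_on_def)
qed (auto simp: frag_extend_diff lookup_minus)

lemma lookup_frag_extend_notin:
  assumes "Poly_Mapping.keys c \<subseteq> S" "z \<notin> f ` S"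
  shows "Poly_Mapping.lookup (frag_extend (\<lambda>y. frag_of (f y)) c) z = 0"
  using assms(1)
proof (induction c rule: frag_induction)
  case (one y)
  then show ?case using assms(2) by (auto simp: lookup_single when_def)
qed (auto simp: frag_extend_diff lookup_minus)

text \<open>Counts the interleavings of \<open>u\<close> and \<open>v\<close> that spell
  \<open>w\<close>; the theorem is proved one such coefficient at a time.\<close>

abbreviation shuffle_count :: "'a list \<Rightarrow> 'a list \<Rightarrow> 'a list \<Rightarrow> int" where
  "shuffle_count u v w \<equiv> Poly_Mapping.lookup (shuffle_words u v) w"

lemma lookup_frag_of: "Poly_Mapping.lookup (frag_of x) y = (if x = y then 1 else 0)"
  by (simp add: lookup_single when_def)

lemma lookup_prepend:
  "Poly_Mapping.lookup (frag_extend (\<lambda>w. frag_of (a # w)) c) (x # w) =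
     (if a = x then Poly_Mapping.lookup c w else 0)"
  using lookup_frag_extend_inj[of c UNIV "Cons a" w]
    lookup_frag_extend_notin[of c UNIV "x # w" "Cons a"] by auto

lemma lookup_prepend_Nil:
  "Poly_Mapping.lookup (frag_extend (\<lambda>w. frag_of (a # w)) c) [] = 0"
  using lookup_frag_extend_notin[of c UNIV "[]" "Cons a"] by auto

lemma shuffle_words_Nil_right [simp]: "shuffle_words w [] = frag_of w"
  by (cases w) auto

lemma shuffle_count_Cons:
  "shuffle_count (a # u) (b # v) (x # w) =
     (if a = x then shuffle_count u (b # v) w else 0) +
     (if b = x then shuffle_count (a # u) v w else 0)"
  by (simp add: lookup_add lookup_prepend)

lemma shuffle_count_Nil: "shuffle_count u v [] = (if u = [] \<and> v = [] then 1 else 0)"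
  by (cases u; cases v) (auto simp: lookup_add lookup_prepend_Nil lookup_frag_of)

lemma shuffle_words_commute: "shuffle_words u v = shuffle_words v u"
proof (induction u v rule: shuffle_words.induct)
  case (3 a u b v)
  show ?case unfolding shuffle_words.simps 3 by (rule add.commute)
qed simp_all

text \<open>Every interleaving uses all letters of both words. Through \<open>length_xword\<close>
  this disposes of the words of blocks whose weight is wrong.\<close>

lemma shuffle_count_length:
  "shuffle_count u v w \<noteq> 0 \<Longrightarrow> length w = length u + length v"
proof (induction w arbitrary: u v)
  case Nil
  then show ?case by (auto simp: shuffle_count_Nil split: if_splits)
next
  case (Cons x w)
  show ?case
  proof (cases "u = [] \<or> v = []")
    case True
    then show ?thesis using Cons.prems by (auto simp: lookup_frag_of split: if_splits)
  next
    case False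
    then obtain a u' b v' where uv: "u = a # u'" "v = b # v'" by (auto simp: neq_Nil_conv)
    then have "shuffle_count u' v w \<noteq> 0 \<or> shuffle_count u v' w \<noteq> 0"
      using Cons.prems
      by (auto simp: shuffle_count_Cons simp del: shuffle_words.simps(3) split: if_splits)
    then show ?thesis using Cons.IH[of u' v] Cons.IH[of u v'] uv by auto
  qed
qed

text \<open>An interleaving ends with the last letter of one of the two words. With \<open>P\<close>
  saying that a letter is some \<open>X b\<close>, this keeps the product in
  \<open>H1\<close>.\<close>

lemma shuffle_count_last:
  assumes "shuffle_count u v w \<noteq> 0"
    and "u = [] \<or> P (last u)" and "v = [] \<or> P (last v)"
  shows "w = [] \<or> P (last w)"
  using assms
proof (induction w arbitrary: u v)
  case (Cons x w)
  \<comment> \<open>The assumption on \<open>x # u'\<close> covers the case that \<open>x\<close>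
    ends its word: for \<open>w = []\<close> both rests are empty and \<open>x\<close> itself is the
    last letter.\<close>
  have step: "P (last (x # w))" if "shuffle_count u' v' w \<noteq> 0" "P (last (x # u'))" "v' = [] \<or> P (last v')" for u' v'
  proof (cases "w = []")
    case True
    then show ?thesis using that by (auto simp: shuffle_count_Nil split: if_splits)
  next
    case False
    have "w = [] \<or> P (last w)"
      using that by (intro Cons.IH[of u' v']) (auto split: if_splits)
    with False show ?thesis by simp
  qed
  show ?case
  proof (cases "u = [] \<or> v = []")
    case True
    then show ?thesis using Cons.prems by (auto simp: lookup_frag_of split: if_splits)
  next
    case False
    then obtain a u' b v' where uv: "u = a # u'" "v = b # v'" by (auto simp: neq_Nil_conv)
    then have "a = x \<and> shuffle_count u' v w \<noteq> 0 \<or> b = x \<and> shuffle_count u v' w \<noteq> 0"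
      using Cons.prems(1)
      by (auto simp: shuffle_count_Cons simp del: shuffle_words.simps(3) split: if_splits)
    then consider "a = x" "shuffle_count u' v w \<noteq> 0" | "b = x" "shuffle_count v' u w \<noteq> 0"
      unfolding shuffle_words_commute[of v' u] by blast
    then show ?thesis
      using Cons.prems(2,3) step[of u' v] step[of v' u] uv by cases auto
  qed
qed simp

text \<open>The word that supplies \<open>X e\<close> has spent all its leading \<open>X0\<close> by
  then; the remaining ones among the \<open>q\<close> come from the other word, and the binomial
  chooses positions. The second summand lists the words in exchanged order, which makes the formula
  symmetric.\<close>

lemma shuffle_count_blocks:
  "shuffle_count (replicate m X0 @ X a # u) (replicate n X0 @ X b # v) (replicate q X0 @ X e # w) =
     (if a = e \<and> m \<le> q \<and> q - m \<le> n
      then int (q choose m) * shuffle_count u (replicate (n - (q - m)) X0 @ X b # v) w else 0) +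
     (if b = e \<and> n \<le> q \<and> q - n \<le> m
      then int (q choose n) * shuffle_count v (replicate (m - (q - n)) X0 @ X a # u) w else 0)"
proof (induction q arbitrary: m n)
  case 0
  show ?case
    using shuffle_words_commute[of v "replicate m X0 @ X a # u"]
    by (cases m; cases n) (simp_all add: shuffle_count_Cons del: shuffle_words.simps(3))
next
  case (Suc q)
  show ?case
  proof (cases m)
    case m: 0
    show ?thesis
    proof (cases n)
      case 0
      with m show ?thesis by (simp add: shuffle_count_Cons del: shuffle_words.simps(3))
    next
      case (Suc n')
      then show ?thesis using m Suc.IH[of 0 n']
        by (auto simp: shuffle_count_Cons simp del: shuffle_words.simps(3))
    qed
  next
    case m: (Suc m')
    show ?thesis
    proof (cases n)
      case 0
      then show ?thesis using m Suc.IH[of m' 0]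
        by (auto simp: shuffle_count_Cons simp del: shuffle_words.simps(3))
    next
      case n: (Suc n')
      \<comment> \<open>Pascal's rule with the range conditions built in. The terms on the left are
        the two possible sources of the first \<open>X0\<close>; \<open>F\<close> counts what is
        left, given the number of \<open>X0\<close> remaining in the other word.\<close>
      have pascal: "(if P \<and> i \<le> q \<and> q - i \<le> Suc j then int (q choose i) * F (Suc j - (q - i)) else 0) +
          (if P \<and> Suc i \<le> q \<and> q - Suc i \<le> j
           then int (q choose Suc i) * F (j - (q - Suc i)) else 0) =
          (if P \<and> Suc i \<le> Suc q \<and> Suc q - Suc i \<le> Suc j
           then int (Suc q choose Suc i) * F (Suc j - (Suc q - Suc i)) else 0)"
        for P i j and F :: "nat \<Rightarrow> int"
      proof (cases "i < q")
        case True
        then obtain d where "q = Suc (i + d)" using less_imp_Suc_add by blast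
        then show ?thesis by (auto simp: algebra_simps)
      qed auto
      have "shuffle_count (replicate m X0 @ X a # u) (replicate n X0 @ X b # v)
          (replicate (Suc q) X0 @ X e # w) =
        shuffle_count (replicate m' X0 @ X a # u) (replicate n X0 @ X b # v)
          (replicate q X0 @ X e # w) +
        shuffle_count (replicate m X0 @ X a # u) (replicate n' X0 @ X b # v)
          (replicate q X0 @ X e # w)"
        by (simp add: m n shuffle_count_Cons del: shuffle_words.simps(3))
      also have "\<dots> =
        (if a = e \<and> m \<le> Suc q \<and> Suc q - m \<le> n
         then int (Suc q choose m) * shuffle_count u (replicate (n - (Suc q - m)) X0 @ X b # v) w
         else 0) +
        (if b = e \<and> n \<le> Suc q \<and> Suc q - n \<le> m
         then int (Suc q choose n) * shuffle_count v (replicate (m - (Suc q - n)) X0 @ X a # u) w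
         else 0)"
        unfolding m n Suc.IH
        using pascal[of "a = e" m' n' "\<lambda>i. shuffle_count u (replicate i X0 @ X b # v) w"]
          pascal[of "b = e" n' m' "\<lambda>i. shuffle_count v (replicate i X0 @ X a # u) w"]
        by linarith
      finally show ?thesis .
    qed
  qed
qed

section \<open>Block recursion\<close>

text \<open>Truncated subtraction is harmless where \<open>droppable\<close> holds: the closing
  letter of the block then remains.\<close>

fun drop_zeros :: "nat \<Rightarrow> (nat \<times> 'g) list \<Rightarrow> (nat \<times> 'g) list" where
  "drop_zeros d [] = []"
| "drop_zeros d ((s, b) # vs) = (s - d, b) # vs"

text \<open>The empty word admits every \<open>d\<close>; a positive \<open>d\<close> is then excluded by comparing weights.\<close>

fun droppable :: "nat \<Rightarrow> (nat \<times> 'g) list \<Rightarrow> bool" where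
  "droppable d [] = True"
| "droppable d ((s, b) # vs) = (d < s)"

abbreviation weight :: "(nat \<times> 'g) list \<Rightarrow> nat" where
  "weight ws \<equiv> sum_list (map fst ws)"

lemma zwords_Cons [simp]: "(s, b) # ws \<in> zwords \<longleftrightarrow> 1 \<le> s \<and> ws \<in> zwords"
  by (auto simp: zwords_def)

lemma zwords_Nil [simp]: "[] \<in> zwords"
  by (simp add: zwords_def)

lemma xword_eq_Nil [simp]: "xword ws = [] \<longleftrightarrow> ws = []"
  by (cases ws) auto

lemma length_xword: "ws \<in> zwords \<Longrightarrow> length (xword ws) = weight ws"
  by (induction ws) auto

text \<open>The contribution of the shuffles whose first letter other than \<open>X0\<close> comes from the first word.\<close>

fun first_block :: "(nat \<times> 'g) list \<Rightarrow> (nat \<times> 'g) list \<Rightarrow> nat \<Rightarrow> 'g \<Rightarrow> (nat \<times> 'g) list \<Rightarrow> int" where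
  "first_block [] vs t e ws = 0"
| "first_block ((r, a) # us) vs t e ws =
     (if a = e \<and> r \<le> t \<and> droppable (t - r) vs
      then int (t - 1 choose (r - 1)) *
        shuffle_count (xword us) (xword (drop_zeros (t - r) vs)) (xword ws)
      else 0)"

lemma shuffle_count_first_block:
  assumes "us \<in> zwords" "vs \<in> zwords" "(t, e) # ws \<in> zwords"
    and "t + weight ws \<le> weight us + weight vs"
  shows "shuffle_count (xword us) (xword vs) (xword ((t, e) # ws)) =
    first_block us vs t e ws + first_block vs us t e ws"
proof -
  \<comment> \<open>One factor is empty. If the tails agree, the weight bound forces
    \<open>t \<le> r\<close>, so \<open>first_block\<close> is nonzero only for
    \<open>t = r\<close>, where its binomial is 1.\<close>
  have single: "Poly_Mapping.lookup (frag_of (xword ((r, a) # us))) (xword ((t, e) # ws)) =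
      first_block ((r, a) # us) [] t e ws"
    if "(r, a) # us \<in> zwords" "t + weight ws \<le> r + weight us" for r a us
  proof -
    have "xword us = xword ws \<longleftrightarrow> us = ws"
      using inj_on_xword that assms(3) by (auto simp: inj_on_def)
    moreover have "us = ws \<Longrightarrow> t \<le> r" using that by simp
    moreover have "r - Suc 0 = t - Suc 0 \<longleftrightarrow> r = t" using that assms(3) by auto
    ultimately show ?thesis
      by (auto simp: replicate_X0_inject lookup_frag_of)
  qed
  show ?thesis
  proof (cases us)
    case us: Nil
    show ?thesis
    proof (cases vs)
      case Nil
      with us show ?thesis using assms(3) by (simp add: lookup_frag_of)
    next
      case (Cons x vs')
      obtain r a where "x = (r, a)" by force
      with us Cons show ?thesis using single[of r a vs'] assms
        by (simp del: xword_simps(2) first_block.simps(2))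
    qed
  next
    case us: (Cons x us')
    obtain r a where x: "x = (r, a)" by force
    show ?thesis
    proof (cases vs)
      case Nil
      with us x show ?thesis using single[of r a us'] assms
        by (simp del: xword_simps(2) first_block.simps(2))
    next
      case (Cons y vs')
      obtain s b where y: "y = (s, b)" by force
      have pos: "1 \<le> r" "1 \<le> s" "1 \<le> t" using assms us Cons x y by auto
      \<comment> \<open>A block with entry \<open>s\<close> holds \<open>s - 1\<close> letters
        \<open>X0\<close>; positivity turns conditions on numbers of \<open>X0\<close> into
        conditions on entries.\<close>
      have eqs: "(r - 1 \<le> t - 1) = (r \<le> t)" "(s - 1 \<le> t - 1) = (s \<le> t)"
        "t - 1 - (r - 1) = t - r" "t - 1 - (s - 1) = t - s"
        "(t - r \<le> s - 1) = (t - r < s)" "(t - s \<le> r - 1) = (t - s < r)"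
        "s - 1 - (t - r) = s - (t - r) - 1" "r - 1 - (t - s) = r - (t - s) - 1"
        using pos by auto
      show ?thesis
        unfolding us Cons x y xword_simps shuffle_count_blocks eqs by simp
    qed
  qed
qed

section \<open>Summation over patterns of suppliers\<close>

fun merge :: "bool list \<Rightarrow> 'a list \<Rightarrow> 'a list \<Rightarrow> 'a list" where
  "merge [] us vs = []"
| "merge (True # p) us vs = hd us # merge p (tl us) vs"
| "merge (False # p) us vs = hd vs # merge p us (tl vs)"

definition shuffle_patterns :: "nat \<Rightarrow> nat \<Rightarrow> bool list set" where
  "shuffle_patterns k l = {p. count_list p True = k \<and> count_list p False = l}"

text \<open>\<open>c\<close> tells which word the preceding letter came from, and \<open>T\<close> counts the letters
  \<open>X0\<close> already taken from the leading block of the other word.\<close>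

fun pattern_coeff :: "bool \<Rightarrow> int \<Rightarrow> bool list \<Rightarrow> (nat \<times> 'g) list \<Rightarrow> (nat \<times> 'g) list \<Rightarrow> int" where
  "pattern_coeff c T [] [] [] = 1"
| "pattern_coeff c T (x # p) ((m, g) # ms) ((t, e) # ws) =
     (if g = e then ibinom (int t - 1) (int m - 1 - (if x = c then 0 else T)) *
        pattern_coeff x (T + int t - int m) p ms ws
      else 0)"
| "pattern_coeff _ _ _ _ _ = 0"

text \<open>The claimed coefficient of \<open>ws\<close>, generalized to a start in the middle of a
  word so that it unfolds block by block. The theorem uses \<open>c = True\<close> and
  \<open>T = 0\<close>.\<close>

definition pattern_sum ::
  "bool \<Rightarrow> int \<Rightarrow> (nat \<times> 'g) list \<Rightarrow> (nat \<times> 'g) list \<Rightarrow> (nat \<times> 'g) list \<Rightarrow> int" where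
  "pattern_sum c T us vs ws =
     (\<Sum>p \<in> shuffle_patterns (length us) (length vs). pattern_coeff c T p (merge p us vs) ws)"

lemma length_merge [simp]: "length (merge p us vs) = length p"
  by (induction p us vs rule: merge.induct) auto

lemma length_pattern: "length p = count_list p True + count_list p False"
  by (induction p) auto

lemma finite_shuffle_patterns [simp]: "finite (shuffle_patterns k l)"
proof (rule finite_subset)
  show "shuffle_patterns k l \<subseteq> {p. set p \<subseteq> UNIV \<and> length p = k + l}"
    by (auto simp: shuffle_patterns_def length_pattern)
qed (rule finite_lists_length_eq, simp)

text \<open>Negating the pattern exchanges the roles of the words, and \<open>pattern_coeff\<close>
  only tests whether consecutive suppliers are equal.\<close>

lemma pattern_sum_swap: "pattern_sum c T us vs ws = pattern_sum (\<not> c) T vs us ws"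
proof -
  have m: "merge (map Not p) vs us = merge p us vs" for p
    by (induction p us vs rule: merge.induct) auto
  have w: "pattern_coeff (\<not> c) T (map Not p) ms ws = pattern_coeff c T p ms ws" for p ms
    by (induction c T p ms ws rule: pattern_coeff.induct) auto
  have cnt: "count_list (map Not p) x = count_list p (\<not> x)" for p x
    by (induction p) auto
  show ?thesis unfolding pattern_sum_def
    by (rule sum.reindex_bij_witness[of _ "map Not" "map Not"])
      (auto simp: shuffle_patterns_def cnt m w comp_def)
qed

text \<open>Counterpart of \<open>first_block\<close>: the terms whose pattern begins with
  \<open>True\<close>. Those beginning with \<open>False\<close> are obtained by exchanging the
  words.\<close>

fun first_pattern_sum ::
  "bool \<Rightarrow> int \<Rightarrow> (nat \<times> 'g) list \<Rightarrow> (nat \<times> 'g) list \<Rightarrow> nat \<Rightarrow> 'g \<Rightarrow> (nat \<times> 'g) list \<Rightarrow> int" where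
  "first_pattern_sum c T [] vs t e ws = 0"
| "first_pattern_sum c T ((r, a) # us) vs t e ws =
     (if a = e then ibinom (int t - 1) (int r - 1 - (if c then 0 else T)) *
        pattern_sum True (T + int t - int r) us vs ws
      else 0)"

lemma pattern_sum_Cons:
  "pattern_sum c T us vs ((t, e) # ws) =
     first_pattern_sum c T us vs t e ws + first_pattern_sum (\<not> c) T vs us t e ws"
proof -
  let ?B = "shuffle_patterns (length us) (length vs)"
  let ?f = "\<lambda>p. pattern_coeff c T p (merge p us vs) ((t, e) # ws)"
  have part: "?B - {[]} = Cons True ` {p. True # p \<in> ?B} \<union> Cons False ` {p. False # p \<in> ?B}"
  proof (intro equalityI subsetI)
    fix p assume "p \<in> ?B - {[]}"
    then show "p \<in> Cons True ` {p. True # p \<in> ?B} \<union> Cons False ` {p. False # p \<in> ?B}"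
      by (cases p; cases "hd p") auto
  qed auto
  have fin: "finite {p. x # p \<in> ?B}" for x
    using finite_vimageI[OF finite_shuffle_patterns, of "Cons x"] by (simp add: vimage_def)
  have "pattern_sum c T us vs ((t, e) # ws) = sum ?f (?B - {[]})"
    unfolding pattern_sum_def by (rule sum.mono_neutral_right) auto
  also have "\<dots> = (\<Sum>p | True # p \<in> ?B. ?f (True # p)) + (\<Sum>p | False # p \<in> ?B. ?f (False # p))"
    unfolding part using fin by (subst sum.union_disjoint) (auto simp: sum.reindex)
  also have "(\<Sum>p | True # p \<in> ?B. ?f (True # p)) = first_pattern_sum c T us vs t e ws"
  proof (cases us)
    case (Cons x us')
    then have "{p. True # p \<in> ?B} = shuffle_patterns (length us') (length vs)"
      by (auto simp: shuffle_patterns_def)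
    with Cons show ?thesis
      by (cases x) (auto simp: pattern_sum_def sum_distrib_left)
  qed (simp add: shuffle_patterns_def)
  also have "(\<Sum>p | False # p \<in> ?B. ?f (False # p)) = first_pattern_sum (\<not> c) T vs us t e ws"
  proof (cases vs)
    case (Cons x vs')
    then have "{p. False # p \<in> ?B} = shuffle_patterns (length us) (length vs')"
      by (auto simp: shuffle_patterns_def)
    moreover have "pattern_sum True T' vs' us ws = pattern_sum False T' us vs' ws" for T'
      using pattern_sum_swap[of True] by simp
    ultimately show ?thesis using Cons
      by (cases x) (simp add: pattern_sum_def flip: sum_distrib_left)
  qed (simp add: shuffle_patterns_def)
  finally show ?thesis .
qed

text \<open>While the first word supplies, \<open>T\<close> can fall only at a vanishing binomial.
  As \<open>vs\<close> is nonempty, the pattern contains a \<open>False\<close>; there the lower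
  entry \<open>s - 1 - T\<close> is negative. If \<open>ws\<close> runs out earlier, the value is 0
  as well.\<close>

lemma pattern_coeff_overdrawn:
  assumes "p \<in> shuffle_patterns (length us) (length vs)"
    and "\<not> droppable (nat T) vs" and "0 \<le> T"
  shows "pattern_coeff True T p (merge p us vs) ws = 0"
  using assms
proof (induction p arbitrary: us T ws)
  case Nil
  then show ?case by (cases vs) (auto simp: shuffle_patterns_def)
next
  case (Cons x p)
  obtain s b vs' where vs: "vs = (s, b) # vs'" using Cons.prems(2) by (cases vs) auto
  show ?case
  proof (cases ws)
    case ws: (Cons y ws')
    obtain t e where y: "y = (t, e)" by force
    show ?thesis
    proof (cases x)
      case True
      with Cons.prems obtain r a us' where us: "us = (r, a) # us'"
        by (cases us) (auto simp: shuffle_patterns_def)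
      show ?thesis
      proof (cases "r \<le> t")
        case le: True
        have "pattern_coeff True (T + int t - int r) p (merge p us' vs) ws' = 0"
          using Cons.prems True us le by (intro Cons.IH) (auto simp: shuffle_patterns_def vs)
        then show ?thesis using True us ws y by simp
      next
        case False
        then show ?thesis using True us ws y by (simp add: ibinom_def)
      qed
    next
      case False
      moreover have "int s - 1 - T < 0" using Cons.prems(2,3) vs by auto
      ultimately show ?thesis using ws y vs by (simp add: ibinom_def)
    qed
  qed (cases x; simp)
qed

lemma pattern_sum_overdrawn:
  "\<not> droppable (nat T) vs \<Longrightarrow> 0 \<le> T \<Longrightarrow> pattern_sum True T us vs ws = 0"
  unfolding pattern_sum_def by (intro sum.neutral ballI pattern_coeff_overdrawn)

text \<open>The invariant of the block recursion: on the left the \<open>T\<close> letters are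
  really removed from the word that did not supply last; on the right the words stay intact and
  \<open>T\<close> is remembered.\<close>

lemma shuffle_count_eq_pattern_sum:
  assumes "us \<in> zwords" "vs \<in> zwords" "ws \<in> zwords"
    and "droppable T (if c then vs else us)"
    and "T + weight ws = weight us + weight vs"
  shows "shuffle_count (xword (if c then us else drop_zeros T us))
      (xword (if c then drop_zeros T vs else vs)) (xword ws) = pattern_sum c (int T) us vs ws"
  using assms
proof (induction ws arbitrary: c T us vs)
  case Nil
  have coeff: "pattern_coeff c (int T) p (merge p us vs) [] = (if p = [] then 1 else 0)" for p
    by (cases p; cases "hd p") auto
  have "drop_zeros T ws = [] \<longleftrightarrow> ws = []" for ws :: "(nat \<times> 'a) list"
    by (cases ws) auto
  then show ?case
    unfolding pattern_sum_def coeff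
    by (simp add: shuffle_count_Nil) (simp add: shuffle_patterns_def)
next
  case (Cons x ws)
  obtain t e where x: "x = (t, e)" by force
  \<comment> \<open>Treating one supplier suffices: the other follows by exchanging the words and
    negating \<open>c\<close>, hence the fresh variables.\<close>
  have half: "first_block (if c then us else drop_zeros T us) (if c then drop_zeros T vs else vs) t e ws =
      first_pattern_sum c (int T) us vs t e ws"
    if z: "us \<in> zwords" "vs \<in> zwords" "droppable T (if c then vs else us)"
      "T + (t + weight ws) = weight us + weight vs" for c us vs
  proof (cases us)
    case us: (Cons y us')
    obtain r a where y: "y = (r, a)" by force
    \<comment> \<open>What is left of the leading block, which has already lost \<open>T\<close>
      letters if the other word supplied last.\<close>
    define r' where "r' = (if c then r else r - T)"
    have r': "1 \<le> r'" "int r - 1 - (if c then 0 else int T) = int r' - 1" "r' \<le> r" "r - r' \<le> T"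
      using z us y by (auto simp: r'_def split: if_splits)
    have u: "(if c then us else drop_zeros T us) = (r', a) # us'"
      by (simp add: us y r'_def)
    have t: "1 \<le> t" "ws \<in> zwords" using Cons.prems(3) x by auto
    show ?thesis
    proof (cases "r' \<le> t")
      case False
      then show ?thesis using r' u us y by (auto simp: ibinom_def)
    next
      case True
      \<comment> \<open>One formula for two cases: if the first word supplies again,
        \<open>t - r\<close> more letters are taken in advance; if the supplier changes,
        \<open>t - (r - T)\<close> letters start a new advance.\<close>
      define T' where "T' = T + t - r"
      have T': "int T' = int T + int t - int r" "T + t = T' + r"
        using True r' by (auto simp: T'_def)
      have dr: "droppable (t - r') (if c then drop_zeros T vs else vs) = droppable T' vs"
        "droppable T' vs \<Longrightarrow> drop_zeros (t - r') (if c then drop_zeros T vs else vs) = drop_zeros T' vs"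
        using z(3) True us y by (cases vs; auto simp: r'_def T'_def)+
      have IH: "shuffle_count (xword us') (xword (drop_zeros T' vs)) (xword ws) =
          pattern_sum True (int T') us' vs ws" if "droppable T' vs"
        using Cons.IH[of us' vs T' True] that z us y t T'(2) by simp
      have bin: "ibinom (int t - 1) (int r' - 1) = int (t - 1 choose (r' - 1))"
        using r'(1) t(1) True by (simp add: ibinom_def nat_diff_distrib)
      have "first_block (if c then us else drop_zeros T us) (if c then drop_zeros T vs else vs) t e ws =
          (if a = e \<and> droppable T' vs
           then int (t - 1 choose (r' - 1)) * pattern_sum True (int T') us' vs ws else 0)"
        unfolding u first_block.simps dr(1) using dr(2) True IH by auto
      moreover have "first_pattern_sum c (int T) us vs t e ws =
          (if a = e then int (t - 1 choose (r' - 1)) * pattern_sum True (int T') us' vs ws else 0)"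
        unfolding us y first_pattern_sum.simps r'(2) bin T'(1) ..
      \<comment> \<open>If \<open>T'\<close> letters cannot be dropped, the left side is 0 by its
        condition and the right side because it is overdrawn.\<close>
      ultimately show ?thesis
        using pattern_sum_overdrawn[of "int T'" vs us' ws] by auto
    qed
  qed (cases c; simp)
  have z: "(if c then us else drop_zeros T us) \<in> zwords" "(if c then drop_zeros T vs else vs) \<in> zwords"
    using Cons.prems by (cases us; cases vs; auto)+
  let ?us = "if c then us else drop_zeros T us" and ?vs = "if c then drop_zeros T vs else vs"
  \<comment> \<open>Only an inequality, because \<open>drop_zeros\<close> takes nothing from an
    empty word.\<close>
  have "t + weight ws \<le> weight ?us + weight ?vs"
    using Cons.prems x by (cases us; cases vs) auto
  then have "shuffle_count (xword ?us) (xword ?vs) (xword ((t, e) # ws)) =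
      first_block ?us ?vs t e ws + first_block ?vs ?us t e ws"
    using Cons.prems(3) x by (intro shuffle_count_first_block z) auto
  also have "first_block ?us ?vs t e ws = first_pattern_sum c (int T) us vs t e ws"
    using Cons.prems x by (intro half) auto
  also have "first_block ?vs ?us t e ws = first_pattern_sum (\<not> c) (int T) vs us t e ws"
    using half[of vs us "\<not> c"] Cons.prems x by (cases c) (simp_all add: add.commute)
  finally show ?case unfolding x pattern_sum_Cons .
qed

section \<open>Closed form of the pattern coefficients\<close>

text \<open>Before position \<open>i\<close> the state has grown to \<open>T\<close> plus the
  partial sum of differences, and \<open>(c # p) ! i\<close> is the preceding supplier, with
  \<open>c\<close> in front of the first.\<close>

lemma pattern_coeff_eq_prod:
  assumes "length ms = length p" "length ws = length p"
  shows "pattern_coeff c T p ms ws =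
    (if map snd ms = map snd ws then
       (\<Prod>i<length p. ibinom (int (fst (ws ! i)) - 1)
          (int (fst (ms ! i)) - 1 -
           (if p ! i = (c # p) ! i then 0
            else T + (\<Sum>j<i. int (fst (ws ! j)) - int (fst (ms ! j))))))
     else 0)"
  using assms
proof (induction p arbitrary: c T ms ws)
  case (Cons x p)
  obtain m g ms' where ms: "ms = (m, g) # ms'" using Cons.prems by (cases ms) auto
  obtain t e ws' where ws: "ws = (t, e) # ws'" using Cons.prems by (cases ws) auto
  have len: "length ms' = length p" "length ws' = length p" using Cons.prems ms ws by auto
  show ?case
    unfolding ms ws
    by (simp add: Cons.IH[OF len] prod.lessThan_Suc_shift sum.lessThan_Suc_shift algebra_simps
        del: prod.lessThan_Suc sum.lessThan_Suc cong: if_cong)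
qed simp

lemma pattern_coeff_length: "pattern_coeff c T p ms ws \<noteq> 0 \<Longrightarrow> length ws = length p"
  by (induction c T p ms ws rule: pattern_coeff.induct) (auto split: if_splits)

text \<open>The number of earlier equal entries of the pattern is the number of letters already
  taken from that word.\<close>

lemma merge_nth:
  assumes "i < length p" "count_list p True \<le> length us" "count_list p False \<le> length vs"
  shows "merge p us vs ! i =
    (if p ! i then us ! count_list (take i p) True else vs ! count_list (take i p) False)"
  using assms
proof (induction p us vs arbitrary: i rule: merge.induct)
  case (2 p us vs)
  then obtain u us' where "us = u # us'" by (cases us) auto
  with 2 show ?case by (cases i) auto
next
  case (3 p us vs)
  then obtain v vs' where "vs = v # vs'" by (cases vs) auto
  with 3 show ?case by (cases i) auto
qed simp

section \<open>Shuffle permutations and patterns\<close>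

lemma count_list_map_upt: "count_list (map f [1..<Suc n]) x = card {j \<in> {1..n}. f j = x}"
proof (induction n)
  case (Suc n)
  have "{j \<in> {1..Suc n}. f j = x} =
      {j \<in> {1..n}. f j = x} \<union> (if f (Suc n) = x then {Suc n} else {})"
    by (auto simp: le_Suc_eq)
  with Suc show ?case by simp
qed simp

definition perm_pattern :: "nat \<Rightarrow> nat \<Rightarrow> (nat \<Rightarrow> nat) \<Rightarrow> bool list" where
  "perm_pattern k l \<sigma> = map (\<lambda>i. \<sigma> i \<le> k) [1..<Suc (k + l)]"

lemma length_perm_pattern [simp]: "length (perm_pattern k l \<sigma>) = k + l"
  by (simp add: perm_pattern_def del: upt_Suc)

lemma perm_pattern_nth: "i < k + l \<Longrightarrow> perm_pattern k l \<sigma> ! i \<longleftrightarrow> \<sigma> (Suc i) \<le> k"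
  by (simp add: perm_pattern_def del: upt_Suc)

lemma count_take_perm_pattern:
  assumes "i \<le> k + l"
  shows "count_list (take i (perm_pattern k l \<sigma>)) x = card {j \<in> {1..i}. (\<sigma> j \<le> k) = x}"
proof -
  have "take i (perm_pattern k l \<sigma>) = map (\<lambda>i. \<sigma> i \<le> k) [1..<Suc i]"
    using assms by (simp add: perm_pattern_def take_map del: upt_Suc)
  then show ?thesis by (simp only: count_list_map_upt)
qed

text \<open>As the inverse increases on each range of values, \<open>\<sigma>\<close> maps the
  positions up to \<open>i\<close> of the same kind as \<open>i\<close> onto the initial segment of
  that range ending in \<open>\<sigma> i\<close>. So the pattern determines the permutation. Here
  \<open>take i\<close> includes position \<open>i\<close> itself.\<close>

lemma shuffle_perm_eq_rank:
  assumes "\<sigma> \<in> shuffle_perms k l" "i \<in> {1..k + l}"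
  shows "\<sigma> i = (if \<sigma> i \<le> k then count_list (take i (perm_pattern k l \<sigma>)) True
    else k + count_list (take i (perm_pattern k l \<sigma>)) False)"
proof -
  have perm: "\<sigma> permutes {1..k + l}" and mono: "strict_mono_on {1..k} (inv \<sigma>)"
    "strict_mono_on {k + 1..k + l} (inv \<sigma>)"
    using assms(1) by (auto simp: shuffle_perms_def)
  have inv: "inv \<sigma> (\<sigma> j) = j" "\<sigma> (inv \<sigma> j) = j" for j
    using permutes_inverses[OF perm] by auto
  have range: "j \<in> {1..k + l} \<longleftrightarrow> \<sigma> j \<in> {1..k + l}" for j
    using permutes_in_image[OF perm] by simp
  have le: "j \<le> i \<longleftrightarrow> \<sigma> j \<le> \<sigma> i"
    if A: "\<sigma> i \<in> A" "\<sigma> j \<in> A" "strict_mono_on A (inv \<sigma>)" for j A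
    using strict_mono_on_less_eq[OF A(3), of "\<sigma> j" "\<sigma> i"] A inv by simp
  have count: "count_list (take i (perm_pattern k l \<sigma>)) x = card (\<sigma> ` {j \<in> {1..i}. (\<sigma> j \<le> k) = x})"
    for x using assms(2) permutes_inj_on[OF perm]
    by (simp add: count_take_perm_pattern card_image)
  show ?thesis
  proof (cases "\<sigma> i \<le> k")
    case True
    have "\<sigma> ` {j \<in> {1..i}. (\<sigma> j \<le> k) = True} = {1..\<sigma> i}"
    proof (intro equalityI subsetI)
      fix y assume "y \<in> \<sigma> ` {j \<in> {1..i}. (\<sigma> j \<le> k) = True}"
      then obtain j where j: "y = \<sigma> j" "j \<in> {1..i}" "\<sigma> j \<le> k" by auto
      then show "y \<in> {1..\<sigma> i}" using le[of "{1..k}" j] range[of j] range[of i] True mono assms(2) by auto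
    next
      fix y assume y: "y \<in> {1..\<sigma> i}"
      then have "inv \<sigma> y \<in> {j \<in> {1..i}. (\<sigma> j \<le> k) = True}"
        using le[of "{1..k}" "inv \<sigma> y"] range[of "inv \<sigma> y"] True mono inv by auto
      then show "y \<in> \<sigma> ` {j \<in> {1..i}. (\<sigma> j \<le> k) = True}" by (rule image_eqI[rotated]) (simp add: inv)
    qed
    with True show ?thesis using count[of True] by simp
  next
    case False
    have i: "\<sigma> i \<le> k + l" using range[of i] assms(2) by simp
    have "\<sigma> ` {j \<in> {1..i}. (\<sigma> j \<le> k) = False} = {k + 1..\<sigma> i}"
    proof (intro equalityI subsetI)
      fix y assume "y \<in> \<sigma> ` {j \<in> {1..i}. (\<sigma> j \<le> k) = False}"
      then obtain j where j: "y = \<sigma> j" "j \<in> {1..i}" "\<not> \<sigma> j \<le> k" by auto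
      then show "y \<in> {k + 1..\<sigma> i}"
        using le[of "{k + 1..k + l}" j] range[of j] i False mono assms(2) by auto
    next
      fix y assume y: "y \<in> {k + 1..\<sigma> i}"
      then have "inv \<sigma> y \<in> {j \<in> {1..i}. (\<sigma> j \<le> k) = False}"
        using le[of "{k + 1..k + l}" "inv \<sigma> y"] range[of "inv \<sigma> y"] i False mono inv by auto
      then show "y \<in> \<sigma> ` {j \<in> {1..i}. (\<sigma> j \<le> k) = False}" by (rule image_eqI[rotated]) (simp add: inv)
    qed
    with False show ?thesis using count[of False] by simp
  qed
qed

lemma perm_pattern_in_shuffle_patterns:
  assumes "\<sigma> \<in> shuffle_perms k l"
  shows "perm_pattern k l \<sigma> \<in> shuffle_patterns k l"
proof -
  have perm: "\<sigma> permutes {1..k + l}" using assms by (auto simp: shuffle_perms_def)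
  have count: "count_list (perm_pattern k l \<sigma>) x = card {y \<in> {1..k + l}. (y \<le> k) = x}" for x
  proof -
    have "count_list (perm_pattern k l \<sigma>) x = card {j \<in> {1..k + l}. (\<sigma> j \<le> k) = x}"
      using count_take_perm_pattern[of "k + l" k l \<sigma> x] by simp
    also have "\<dots> = card (\<sigma> ` {j \<in> {1..k + l}. (\<sigma> j \<le> k) = x})"
      using permutes_inj_on[OF perm] by (simp add: card_image)
    also have "\<sigma> ` {j \<in> {1..k + l}. (\<sigma> j \<le> k) = x} = {y \<in> \<sigma> ` {1..k + l}. (y \<le> k) = x}"
      by auto
    finally show ?thesis using permutes_image[OF perm] by simp
  qed
  have "{y \<in> {1..k + l}. (y \<le> k) = True} = {1..k}" "{y \<in> {1..k + l}. (y \<le> k) = False} = {k + 1..k + l}"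
    by auto
  with count show ?thesis by (simp add: shuffle_patterns_def)
qed

lemma count_list_take_le: "count_list (take i p) x \<le> count_list p x"
  by (metis append_take_drop_id count_list_append le_add1)

lemma count_list_take_mono: "i \<le> j \<Longrightarrow> count_list (take i p) x \<le> count_list (take j p) x"
  using count_list_take_le[of i "take j p" x] by (simp add: min_def)

lemma count_list_take_Suc:
  "i < length p \<Longrightarrow> count_list (take (Suc i) p) x = count_list (take i p) x + (if p ! i = x then 1 else 0)"
  by (simp add: take_Suc_conv_app_nth)

text \<open>Injectivity follows from the rank formula; for surjectivity the same formula defines the
  preimage \<open>f\<close>.\<close>

lemma bij_betw_perm_pattern: "bij_betw (perm_pattern k l) (shuffle_perms k l) (shuffle_patterns k l)"
  unfolding bij_betw_def
proof (intro conjI equalityI subsetI inj_onI)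
  fix \<sigma> \<tau> assume \<sigma>: "\<sigma> \<in> shuffle_perms k l" and \<tau>: "\<tau> \<in> shuffle_perms k l"
    and eq: "perm_pattern k l \<sigma> = perm_pattern k l \<tau>"
  show "\<sigma> = \<tau>"
  proof
    fix i
    show "\<sigma> i = \<tau> i"
    proof (cases "i \<in> {1..k + l}")
      case True
      then have "\<sigma> i \<le> k \<longleftrightarrow> \<tau> i \<le> k"
        using perm_pattern_nth[of "i - 1" k l \<sigma>] perm_pattern_nth[of "i - 1" k l \<tau>] eq by auto
      then show ?thesis
        using shuffle_perm_eq_rank[OF \<sigma> True] shuffle_perm_eq_rank[OF \<tau> True] eq by presburger
    next
      case False
      then show ?thesis
        using \<sigma> \<tau> by (auto simp: shuffle_perms_def permutes_not_in)
    qed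
  qed
next
  fix p assume "p \<in> perm_pattern k l ` shuffle_perms k l"
  then show "p \<in> shuffle_patterns k l" using perm_pattern_in_shuffle_patterns by auto
next
  fix p assume p: "p \<in> shuffle_patterns k l"
  then have cnt: "count_list p True = k" "count_list p False = l" and len: "length p = k + l"
    by (auto simp: shuffle_patterns_def length_pattern)
  define f where "f i = (if i \<in> {1..k + l} then
      (if p ! (i - 1) then count_list (take i p) True else k + count_list (take i p) False)
      else i)" for i
  \<comment> \<open>Position \<open>i\<close> counts itself, so ranks begin at 1.\<close>
  have pos: "0 < count_list (take i p) (p ! (i - 1))" if "i \<in> {1..k + l}" for i
    using that len by (cases i) (simp_all add: count_list_take_Suc)
  have f_le: "f i \<in> {1..k}" if "i \<in> {1..k + l}" "p ! (i - 1)" for i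
    using that pos[of i] count_list_take_le[of i p True] cnt by (simp add: f_def)
  have f_gt: "f i \<in> {k + 1..k + l}" if "i \<in> {1..k + l}" "\<not> p ! (i - 1)" for i
    using that pos[of i] count_list_take_le[of i p False] cnt by (simp add: f_def)
  have f_less: "f i < f j" if "i < j" "i \<in> {1..k + l}" "j \<in> {1..k + l}" "p ! (i - 1) = p ! (j - 1)" for i j
    using that len count_list_take_mono[of i "j - 1" p "p ! (j - 1)"]
    by (cases j) (auto simp: f_def count_list_take_Suc)
  have f_iff: "f i \<le> k \<longleftrightarrow> p ! (i - 1)" if "i \<in> {1..k + l}" for i
    using f_le[of i] f_gt[of i] that by (cases "p ! (i - 1)") auto
  have inj: "inj_on f {1..k + l}"
  proof (rule inj_onI)
    fix i j assume ij: "i \<in> {1..k + l}" "j \<in> {1..k + l}" "f i = f j"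
    then have "p ! (i - 1) = p ! (j - 1)" using f_iff by metis
    then show "i = j" using ij f_less[of i j] f_less[of j i] by (cases i j rule: linorder_cases) auto
  qed
  have sub: "f ` {1..k + l} \<subseteq> {1..k + l}"
  proof
    fix y assume "y \<in> f ` {1..k + l}"
    then obtain i where "y = f i" "i \<in> {1..k + l}" by auto
    then show "y \<in> {1..k + l}" using f_le[of i] f_gt[of i] by (cases "p ! (i - 1)") auto
  qed
  have perm: "f permutes {1..k + l}"
  proof (rule bij_imp_permutes)
    show "bij_betw f {1..k + l} {1..k + l}"
      using endo_inj_surj[OF _ sub inj] inj by (simp add: bij_betw_def)
  qed (auto simp: f_def)
  \<comment> \<open>Each range of values comes from positions of one kind, along which
    \<open>f\<close> increases.\<close>
  have mono: "strict_mono_on A (inv f)" if "A = {1..k} \<or> A = {k + 1..k + l}" for A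
  proof (rule strict_mono_onI)
    fix x y assume xy: "x \<in> A" "y \<in> A" "x < y"
    have f_inv: "f (inv f z) = z" for z using permutes_inverses[OF perm] by simp
    have rng: "inv f x \<in> {1..k + l}" "inv f y \<in> {1..k + l}"
      using xy that unfolding permutes_in_image[OF permutes_inv[OF perm]] by auto
    have "x \<le> k \<longleftrightarrow> y \<le> k" using xy that by auto
    then have same: "p ! (inv f x - 1) = p ! (inv f y - 1)"
      using f_iff[OF rng(1)] f_iff[OF rng(2)] f_inv by simp
    show "inv f x < inv f y"
    proof (rule ccontr)
      assume "\<not> inv f x < inv f y"
      then consider "inv f x = inv f y" | "inv f y < inv f x" by linarith
      then show False
      proof cases
        case 1
        then show False using f_inv xy(3) by (metis less_irrefl)
      next
        case 2
        then show False using f_less[OF 2 rng(2,1)] same f_inv xy(3) by simp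
      qed
    qed
  qed
  have "f \<in> shuffle_perms k l" using perm mono by (simp add: shuffle_perms_def)
  moreover have "perm_pattern k l f = p"
    using f_iff len by (intro nth_equalityI) (auto simp: perm_pattern_nth)
  ultimately show "p \<in> perm_pattern k l ` shuffle_perms k l" by blast
qed

section \<open>Vectors rearranged by a shuffle permutation\<close>

lemma shuffle_vec_nth:
  "i < length a + length b \<Longrightarrow> shuffle_vec \<sigma> a b ! i = (a @ b) ! (\<sigma> (Suc i) - 1)"
  by (simp add: shuffle_vec_def entry_def del: upt_Suc)

lemma length_shuffle_vec [simp]: "length (shuffle_vec \<sigma> a b) = length a + length b"
  by (simp add: shuffle_vec_def del: upt_Suc)

text \<open>The rank of a position counts the position itself, the index in \<open>merge_nth\<close>
  does not; numbering vectors from 1 absorbs the difference.\<close>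

lemma shuffle_vec_eq_merge:
  assumes "\<sigma> \<in> shuffle_perms (length a) (length b)"
  shows "shuffle_vec \<sigma> a b = merge (perm_pattern (length a) (length b) \<sigma>) a b"
proof (rule nth_equalityI)
  let ?p = "perm_pattern (length a) (length b) \<sigma>"
  fix i assume "i < length (shuffle_vec \<sigma> a b)"
  then have i: "i < length a + length b" by simp
  have cnt: "count_list ?p True = length a" "count_list ?p False = length b"
    using perm_pattern_in_shuffle_patterns[OF assms] by (auto simp: shuffle_patterns_def)
  have "\<sigma> (Suc i) = (if ?p ! i then Suc (count_list (take i ?p) True)
      else length a + Suc (count_list (take i ?p) False))"
    using shuffle_perm_eq_rank[OF assms, of "Suc i"] i
    unfolding perm_pattern_nth[OF i, symmetric]
    by (cases "?p ! i") (simp_all add: count_list_take_Suc)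
  moreover have "count_list (take i ?p) True < length a" if "?p ! i"
    using that i cnt count_list_take_le[of "Suc i" ?p True] by (simp add: count_list_take_Suc)
  ultimately show "shuffle_vec \<sigma> a b ! i = merge ?p a b ! i"
    using i cnt by (simp add: shuffle_vec_nth merge_nth nth_append)
qed simp

lemma shuffle_vec_zip:
  assumes "\<sigma> permutes {1..length a + length b}" "length r = length a" "length s = length b"
  shows "shuffle_vec \<sigma> (zip r a) (zip s b) = zip (shuffle_vec \<sigma> r s) (shuffle_vec \<sigma> a b)"
proof (rule nth_equalityI)
  fix i assume "i < length (shuffle_vec \<sigma> (zip r a) (zip s b))"
  then have i: "i < length a + length b" using assms by simp
  then have "\<sigma> (Suc i) \<in> {1..length a + length b}"
    using permutes_in_image[OF assms(1)] by auto
  then show "shuffle_vec \<sigma> (zip r a) (zip s b) ! i =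
      zip (shuffle_vec \<sigma> r s) (shuffle_vec \<sigma> a b) ! i"
    using i assms nth_zip[of "\<sigma> (Suc i) - 1" "r @ s" "a @ b"] by (auto simp: shuffle_vec_nth)
qed (use assms in simp)

lemma pattern_coeff_perm_pattern:
  assumes \<sigma>: "\<sigma> \<in> shuffle_perms k l"
    and len: "length r = k" "length a = k" "length s = l" "length b = l" "length ws = k + l"
  shows "pattern_coeff True 0 (perm_pattern k l \<sigma>)
      (merge (perm_pattern k l \<sigma>) (zip r a) (zip s b)) ws =
    (if shuffle_vec \<sigma> a b = map snd ws then shuffle_coeff k l (r @ s) \<sigma> (map fst ws) else 0)"
proof -
  let ?p = "perm_pattern k l \<sigma>"
  let ?ms = "zip (shuffle_vec \<sigma> r s) (shuffle_vec \<sigma> a b)"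
  have perm: "\<sigma> permutes {1..k + l}" using \<sigma> by (simp add: shuffle_perms_def)
  have ms: "merge ?p (zip r a) (zip s b) = ?ms"
    using shuffle_vec_eq_merge[of \<sigma> "zip r a" "zip s b"] shuffle_vec_zip[of \<sigma> a b r s] \<sigma> perm len
    by simp
  have fst_ms: "fst (?ms ! i) = entry (r @ s) (\<sigma> (Suc i))" if "i < k + l" for i
    using that len by (simp add: shuffle_vec_nth entry_def)
  have fst_ws: "fst (ws ! i) = entry (map fst ws) (Suc i)" if "i < k + l" for i
    using that len by (simp add: entry_def)
  have sigma_pos: "1 \<le> \<sigma> (Suc i)" if "i < k + l" for i
    using permutes_in_image[OF perm, of "Suc i"] that by auto
  \<comment> \<open>The product of consecutive signs is -1 exactly when the supplier changes. At
    \<open>i = 0\<close> the start value \<open>True\<close> and the convention for index 0 may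
    disagree, but both multiply the empty sum \<open>S 0\<close>.\<close>
  have sign: "(if ?p ! i = (True # ?p) ! i then 0 else 0 + S i) =
      (1 - eps k \<sigma> (Suc i) * eps k \<sigma> i) div 2 * S i"
    if "i < k + l" "S 0 = 0" for i and S :: "nat \<Rightarrow> int"
    using that sigma_pos[of i] sigma_pos[of "i - 1"]
    by (cases i) (auto simp: eps_def perm_pattern_nth)
  have sums: "(\<Sum>j<i. int (fst (ws ! j)) - int (fst (?ms ! j))) =
      (\<Sum>j = 1..i. int (entry (map fst ws) j) - int (entry (r @ s) (\<sigma> j)))" if "i < k + l" for i
    using that by (simp add: sum.atLeast1_atMost_eq fst_ms fst_ws)
  have "(\<Prod>i<length ?p. ibinom (int (fst (ws ! i)) - 1)
          (int (fst (?ms ! i)) - 1 -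
           (if ?p ! i = (True # ?p) ! i then 0
            else 0 + (\<Sum>j<i. int (fst (ws ! j)) - int (fst (?ms ! j)))))) =
      shuffle_coeff k l (r @ s) \<sigma> (map fst ws)"
    unfolding shuffle_coeff_def One_nat_def prod.atLeast1_atMost_eq length_perm_pattern
  proof (rule prod.cong[OF refl])
    fix i assume "i \<in> {..<k + l}"
    then have i: "i < k + l" by simp
    show "ibinom (int (fst (ws ! i)) - 1) (int (fst (?ms ! i)) - 1 -
           (if ?p ! i = (True # ?p) ! i then 0
            else 0 + (\<Sum>j<i. int (fst (ws ! j)) - int (fst (?ms ! j))))) =
      ibinom (int (entry (map fst ws) (Suc i)) - 1)
          (int (entry (r @ s) (\<sigma> (Suc i))) - 1 -
           (1 - eps k \<sigma> (Suc i) * eps k \<sigma> (Suc i - Suc 0)) div 2 *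
           (\<Sum>j = Suc 0..Suc i - Suc 0. int (entry (map fst ws) j) - int (entry (r @ s) (\<sigma> j))))"
      using sign[OF i, of "\<lambda>i. \<Sum>j<i. int (fst (ws ! j)) - int (fst (?ms ! j))"]
      by (simp only: fst_ms[OF i] fst_ws[OF i] sums[OF i]) simp
  qed
  moreover have "length ?ms = length ?p" "length ws = length ?p" "map snd ?ms = shuffle_vec \<sigma> a b"
    using len by simp_all
  ultimately show ?thesis
    by (simp only: ms pattern_coeff_eq_prod)
qed

section \<open>The product formula\<close>

text \<open>On \<open>H1\<close>, \<open>rho\<close> relabels the basis words injectively, so
  coefficients are carried over along \<open>xword\<close>.\<close>

lemma lookup_rho:
  assumes "c \<in> H1"
  shows "Poly_Mapping.lookup (rho c) ws =
    (if ws \<in> zwords then Poly_Mapping.lookup c (xword ws) else 0)"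
proof -
  have keys: "Poly_Mapping.keys c \<subseteq> xword ` zwords" using assms by (simp add: H1_def xword_image)
  show ?thesis
  proof (cases "ws \<in> zwords")
    case True
    then show ?thesis
      using lookup_frag_extend_inj[OF keys inj_on_inv_into[OF subset_refl], of "xword ws"]
      by (simp add: rho_def inv_into_f_f[OF inj_on_xword])
  next
    case False
    then have "ws \<notin> inv_into zwords xword ` xword ` zwords"
      by (auto simp: inv_into_into)
    with False show ?thesis using lookup_frag_extend_notin[OF keys] by (simp add: rho_def)
  qed
qed

lemma shuffle_words_xword_in_H1: "shuffle_words (xword us) (xword vs) \<in> H1"
proof -
  have last: "xword ws = [] \<or> (\<exists>b. last (xword ws) = X b)" for ws :: "(nat \<times> 'a) list"
    by (induction ws) (auto split: if_splits)
  show ?thesis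
    using shuffle_count_last[of "xword us" "xword vs" _ "\<lambda>x. \<exists>b. x = X b", OF _ last last]
    by (auto simp: H1_def in_keys_iff)
qed

theorem theorem5p1:
  fixes k l :: nat and r s :: "nat list" and a b :: "'g list"
  assumes "k \<ge> 1" and "l \<ge> 1"
    and "length r = k" and "\<forall>x \<in> set r. 1 \<le> x" and "length a = k"
    and "length s = l" and "\<forall>x \<in> set s. 1 \<le> x" and "length b = l"
  shows "shuffle_rho (two_row r a) (two_row s b) =
    (\<Sum>(\<sigma>, t) \<in> shuffle_perms k l \<times> compositions (k + l) (sum_list r + sum_list s).
       frag_cmul (shuffle_coeff k l (r @ s) \<sigma> t) (two_row t (shuffle_vec \<sigma> a b)))"
proof (rule poly_mapping_eqI)
  fix ws :: "(nat \<times> 'g) list"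
  let ?us = "zip r a" and ?vs = "zip s b" and ?C = "compositions (k + l) (sum_list r + sum_list s)"
  have z: "?us \<in> zwords" "?vs \<in> zwords"
    using assms by (auto simp: zwords_def dest: set_zip_leftD)
  have len: "length ?us = k" "length ?vs = l" and wt: "weight ?us = sum_list r" "weight ?vs = sum_list s"
    using assms by auto
  have "shuffle_rho (two_row r a) (two_row s b) = rho (shuffle_words (xword ?us) (xword ?vs))"
    using z by (simp add: shuffle_rho_def two_row_def shuffle_def rho_inv_word)
  then have lhs: "Poly_Mapping.lookup (shuffle_rho (two_row r a) (two_row s b)) ws =
      (if ws \<in> zwords then shuffle_count (xword ?us) (xword ?vs) (xword ws) else 0)"
    by (simp add: lookup_rho shuffle_words_xword_in_H1)
  \<comment> \<open>Comparing a single term with \<open>ws\<close> splits into its two rows, so the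
    sum over \<open>t\<close> collapses to \<open>t = map fst ws\<close>.\<close>
  have word: "Poly_Mapping.lookup (two_row t (shuffle_vec \<sigma> a b)) ws =
      (if t = map fst ws \<and> shuffle_vec \<sigma> a b = map snd ws then 1 else 0)"
    if "t \<in> ?C" for \<sigma> t
  proof -
    have "length t = length (shuffle_vec \<sigma> a b)"
      using that assms by (simp add: compositions_def)
    then have "zip t (shuffle_vec \<sigma> a b) = ws \<longleftrightarrow> t = map fst ws \<and> shuffle_vec \<sigma> a b = map snd ws"
      by (metis map_fst_zip map_snd_zip zip_map_fst_snd)
    then show ?thesis by (simp only: two_row_def lookup_frag_of)
  qed
  have comp: "map fst ws \<in> ?C \<longleftrightarrow>
      ws \<in> zwords \<and> length ws = k + l \<and> weight ws = sum_list r + sum_list s"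
    by (auto simp: compositions_def zwords_def)
  have "Poly_Mapping.lookup (\<Sum>(\<sigma>, t) \<in> shuffle_perms k l \<times> ?C.
       frag_cmul (shuffle_coeff k l (r @ s) \<sigma> t) (two_row t (shuffle_vec \<sigma> a b))) ws =
    (\<Sum>\<sigma> \<in> shuffle_perms k l. \<Sum>t \<in> ?C. shuffle_coeff k l (r @ s) \<sigma> t *
       Poly_Mapping.lookup (two_row t (shuffle_vec \<sigma> a b)) ws)"
    by (simp add: lookup_sum case_prod_unfold sum.cartesian_product)
  also have "\<dots> = (\<Sum>\<sigma> \<in> shuffle_perms k l. if map fst ws \<in> ?C \<and> shuffle_vec \<sigma> a b = map snd ws
       then shuffle_coeff k l (r @ s) \<sigma> (map fst ws) else 0)"
  proof (rule sum.cong[OF refl])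
    fix \<sigma>
    have "(\<Sum>t \<in> ?C. shuffle_coeff k l (r @ s) \<sigma> t *
        Poly_Mapping.lookup (two_row t (shuffle_vec \<sigma> a b)) ws) =
      (\<Sum>t \<in> ?C. if t = map fst ws then
         (if shuffle_vec \<sigma> a b = map snd ws then shuffle_coeff k l (r @ s) \<sigma> t else 0) else 0)"
      by (rule sum.cong) (simp_all add: word)
    then show "(\<Sum>t \<in> ?C. shuffle_coeff k l (r @ s) \<sigma> t *
        Poly_Mapping.lookup (two_row t (shuffle_vec \<sigma> a b)) ws) =
      (if map fst ws \<in> ?C \<and> shuffle_vec \<sigma> a b = map snd ws
       then shuffle_coeff k l (r @ s) \<sigma> (map fst ws) else 0)"
      by (simp add: finite_compositions)
  qed
  also have "\<dots> = (if ws \<in> zwords then shuffle_count (xword ?us) (xword ?vs) (xword ws) else 0)"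
  proof (cases "ws \<in> zwords \<and> weight ws = sum_list r + sum_list s")
    case True
    \<comment> \<open>The block recursion starts with nothing taken in advance.\<close>
    have drop: "droppable 0 ?vs" "drop_zeros 0 ?vs = ?vs"
      using z(2) by (cases "?vs"; auto)+
    have "shuffle_count (xword ?us) (xword ?vs) (xword ws) = pattern_sum True 0 ?us ?vs ws"
      using shuffle_count_eq_pattern_sum[of ?us ?vs ws 0 True] z drop True wt by simp
    also have "\<dots> = (\<Sum>\<sigma> \<in> shuffle_perms k l. pattern_coeff True 0 (perm_pattern k l \<sigma>)
        (merge (perm_pattern k l \<sigma>) ?us ?vs) ws)"
      unfolding pattern_sum_def len
      by (rule sum.reindex_bij_betw[OF bij_betw_perm_pattern, symmetric])
    also have "\<dots> = (\<Sum>\<sigma> \<in> shuffle_perms k l. if map fst ws \<in> ?C \<and> shuffle_vec \<sigma> a b = map snd ws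
       then shuffle_coeff k l (r @ s) \<sigma> (map fst ws) else 0)"
    proof (rule sum.cong[OF refl])
      fix \<sigma> assume \<sigma>: "\<sigma> \<in> shuffle_perms k l"
      show "pattern_coeff True 0 (perm_pattern k l \<sigma>) (merge (perm_pattern k l \<sigma>) ?us ?vs) ws =
        (if map fst ws \<in> ?C \<and> shuffle_vec \<sigma> a b = map snd ws
         then shuffle_coeff k l (r @ s) \<sigma> (map fst ws) else 0)"
      proof (cases "length ws = k + l")
        case len: True
        then show ?thesis using True comp pattern_coeff_perm_pattern[OF \<sigma>, of r a s b ws] assms by simp
      next
        case False
        \<comment> \<open>For a word of another length both sides vanish: its upper row is not among
          the compositions, and neither is \<open>ws\<close> reached by any pattern.\<close>
        then have "map fst ws \<notin> ?C" using comp by blast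
        with False show ?thesis
          using pattern_coeff_length[of True 0 "perm_pattern k l \<sigma>"] by fastforce
      qed
    qed
    finally show ?thesis using True by simp
  next
    case False
    then have "map fst ws \<notin> ?C" using comp by blast
    \<comment> \<open>With the wrong weight, the letter words have incompatible lengths.\<close>
    moreover have "shuffle_count (xword ?us) (xword ?vs) (xword ws) = 0" if "ws \<in> zwords"
      using shuffle_count_length[of "xword ?us" "xword ?vs" "xword ws"] False that z wt
      by (auto simp: length_xword)
    ultimately show ?thesis by simp
  qed
  finally show "Poly_Mapping.lookup (shuffle_rho (two_row r a) (two_row s b)) ws = Poly_Mapping.lookup (\<Sum>(\<sigma>, t) \<in> shuffle_perms k l \<times> ?C.
       frag_cmul (shuffle_coeff k l (r @ s) \<sigma> t) (two_row t (shuffle_vec \<sigma> a b))) ws"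
    using lhs by simp
qed

end
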